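(* For a formula $\phi$, a variable $x$ and a variable $a$, the formula $(\mathrm{Sing}(a)\,\&\,\forall x\,\phi)\Rightarrow\phi[x:=a]$ is derivable.
   Context: Formal system. Objects are generated from the constant $\varnothing$ by: $(\alpha)^{\mathsf c}$, $(\alpha)^{\mathsf v}$ (variables are objects of this form), $(\alpha\,\&\,\beta)$ (federation), $(\alpha\Rightarrow\beta)$ (containment/implication), $(\alpha\cap\beta)$, and classes $\{x\mid\beta\}$ ($x$ a variable, which becomes a bound index). $\alpha[x:=\beta]$ replaces every free appearance of $x$ by $\beta$. A formula is an object of the form $\alpha\Rightarrow\beta$. Abbreviations: $\bot:=\varnothing^{\mathsf c}$; $\neg a:=(a\Rightarrow\bot)$; $\bar a:=(\varnothing\Rightarrow a)$; $a\vee b:=\overline{\bar a\cap\bar b}$; $a=b:=(a\Rightarrow b)\&(b\Rightarrow a)$; $a\neq b:=\neg(a=b)$; $\mathrm{Sing}(a):=(\bar a\neq a)\,\&\,((a\Rightarrow b)\Rightarrow(\bar b\vee a=b))$, with $b$ a variable; $a\in b:=\mathrm{Sing}(a)\&(b\Rightarrow a)$; $V:=\{x\mid\varnothing\}$; $\forall x\,\phi:=(V=\{x\mid\phi\})$; $\exists x\,\phi:=(\varnothing\neq\{x\mid\phi\})$. Rules: R1 from $\alpha$ and $\alpha\Rightarrow\beta$ infer $\beta$; R2 from $\alpha$ infer $\alpha[x:=\beta]$; R3 if $x$ does not appear in $\gamma$, from $\gamma\Rightarrow(\alpha\Rightarrow\beta)$ infer $\gamma\Rightarrow(\{x\mid\beta\}\Rightarrow\{x\mid\alpha\})$.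 Axioms ($a,b,c,d,x$ variables): A1 $((c\Rightarrow a)\&(c\Rightarrow(a\Rightarrow b)))\Rightarrow(c\Rightarrow b)$; A2 $((d\Rightarrow(a\Rightarrow b))\&(d\Rightarrow(b\Rightarrow c)))\Rightarrow(d\Rightarrow(a\Rightarrow c))$; A3 $((c\Rightarrow a)\&(c\Rightarrow b))\Rightarrow(c\Rightarrow(a\&b))$; A4 $(a\&b)\Rightarrow a$, $(a\&b)\Rightarrow b$; A5 $a\Rightarrow(a\cap b)$, $b\Rightarrow(a\cap b)$; A6 $((a\Rightarrow c)\&(b\Rightarrow c))\Rightarrow((a\cap b)\Rightarrow c)$; A7 $a\Rightarrow a$; A8 $a\Rightarrow\varnothing$; A9 $\bot\Rightarrow a$; A10 $(\varnothing\Rightarrow a)\Rightarrow((\varnothing\Rightarrow b)\Rightarrow(a\&b))$; A11 $(a\Rightarrow b)\Rightarrow(\varnothing\Rightarrow(a\Rightarrow b))$; A12 $(((a\Rightarrow b)\Rightarrow\bot)\Rightarrow\bot)\Rightarrow(a\Rightarrow b)$; A13 (schema) $a\in\{x\mid\alpha\}=(\mathrm{Sing}(a)\&\alpha[x:=a])$; A14a $a\Rightarrow\{x\mid x\in a\}$; A14b $(V\Rightarrow a)\Rightarrow(\{x\mid x\in a\}\Rightarrow a)$. *)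

theory Defs
  imports Main
begin

text \<open>
  Objects in locally nameless form: an index bound by a class is a de Bruijn index \<open>Idx i\<close>,
  whereas variables proper are of the form \<open>Var \<nu>\<close>. Both \<open>Con \<nu>\<close> and \<open>Var \<nu>\<close> are atomic symbols
  named by the object \<open>\<nu>\<close>: variables occurring inside a name are neither free in the symbol
  nor affected by substitution or by class formation.
\<close>

datatype obj =
    Empty
  | Con obj
  | Var obj
  | Fed obj obj  (infixr "\<^bold>&" 65)
  | Imp obj obj  (infixr "\<^bold>\<Rightarrow>" 55)
  | Cap obj obj  (infixl "\<^bold>\<inter>" 70)
  | Cls obj
  | Idx nat

fun bind :: "nat \<Rightarrow> obj \<Rightarrow> obj \<Rightarrow> obj" where
  "bind k x Empty = Empty"
| "bind k x (Con \<nu>) = Con \<nu>"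
| "bind k x (Var \<nu>) = (if Var \<nu> = x then Idx k else Var \<nu>)"
| "bind k x (\<alpha> \<^bold>& \<beta>) = (bind k x \<alpha> \<^bold>& bind k x \<beta>)"
| "bind k x (\<alpha> \<^bold>\<Rightarrow> \<beta>) = (bind k x \<alpha> \<^bold>\<Rightarrow> bind k x \<beta>)"
| "bind k x (\<alpha> \<^bold>\<inter> \<beta>) = (bind k x \<alpha> \<^bold>\<inter> bind k x \<beta>)"
| "bind k x (Cls \<alpha>) = Cls (bind (Suc k) x \<alpha>)"
| "bind k x (Idx i) = Idx i"

definition cls :: "obj \<Rightarrow> obj \<Rightarrow> obj"  ("(1\<lbrace>_ |/ _\<rbrace>)") where
  "\<lbrace>x | \<beta>\<rbrace> = Cls (bind 0 x \<beta>)"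

text \<open>Substitution cannot capture, since substituted objects contain no dangling index.\<close>

fun subst :: "obj \<Rightarrow> obj \<Rightarrow> obj \<Rightarrow> obj"  ("_\<lbrakk>_ :=/ _\<rbrakk>" [1000, 0, 0] 1000) where
  "Empty\<lbrakk>x := \<gamma>\<rbrakk> = Empty"
| "(Con \<nu>)\<lbrakk>x := \<gamma>\<rbrakk> = Con \<nu>"
| "(Var \<nu>)\<lbrakk>x := \<gamma>\<rbrakk> = (if Var \<nu> = x then \<gamma> else Var \<nu>)"
| "(\<alpha> \<^bold>& \<beta>)\<lbrakk>x := \<gamma>\<rbrakk> = (\<alpha>\<lbrakk>x := \<gamma>\<rbrakk> \<^bold>& \<beta>\<lbrakk>x := \<gamma>\<rbrakk>)"
| "(\<alpha> \<^bold>\<Rightarrow> \<beta>)\<lbrakk>x := \<gamma>\<rbrakk> = (\<alpha>\<lbrakk>x := \<gamma>\<rbrakk> \<^bold>\<Rightarrow> \<beta>\<lbrakk>x := \<gamma>\<rbrakk>)"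
| "(\<alpha> \<^bold>\<inter> \<beta>)\<lbrakk>x := \<gamma>\<rbrakk> = (\<alpha>\<lbrakk>x := \<gamma>\<rbrakk> \<^bold>\<inter> \<beta>\<lbrakk>x := \<gamma>\<rbrakk>)"
| "(Cls \<alpha>)\<lbrakk>x := \<gamma>\<rbrakk> = Cls (\<alpha>\<lbrakk>x := \<gamma>\<rbrakk>)"
| "(Idx i)\<lbrakk>x := \<gamma>\<rbrakk> = Idx i"

fun vars :: "obj \<Rightarrow> obj set" where
  "vars Empty = {}"
| "vars (Con \<nu>) = {}"
| "vars (Var \<nu>) = {Var \<nu>}"
| "vars (\<alpha> \<^bold>& \<beta>) = vars \<alpha> \<union> vars \<beta>"
| "vars (\<alpha> \<^bold>\<Rightarrow> \<beta>) = vars \<alpha> \<union> vars \<beta>"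
| "vars (\<alpha> \<^bold>\<inter> \<beta>) = vars \<alpha> \<union> vars \<beta>"
| "vars (Cls \<alpha>) = vars \<alpha>"
| "vars (Idx i) = {}"

text \<open>
  Only these terms are objects of the system; \<open>obj\<close> also contains terms with dangling indices.
\<close>

inductive object :: "obj \<Rightarrow> bool" where
  "object Empty"
| "object \<alpha> \<Longrightarrow> object (Con \<alpha>)"
| "object \<alpha> \<Longrightarrow> object (Var \<alpha>)"
| "object \<alpha> \<Longrightarrow> object \<beta> \<Longrightarrow> object (\<alpha> \<^bold>& \<beta>)"
| "object \<alpha> \<Longrightarrow> object \<beta> \<Longrightarrow> object (\<alpha> \<^bold>\<Rightarrow> \<beta>)"
| "object \<alpha> \<Longrightarrow> object \<beta> \<Longrightarrow> object (\<alpha> \<^bold>\<inter> \<beta>)"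
| "object \<nu> \<Longrightarrow> object \<beta> \<Longrightarrow> object \<lbrace>Var \<nu> | \<beta>\<rbrace>"

definition variable :: "obj \<Rightarrow> bool" where
  "variable x \<longleftrightarrow> (\<exists>\<nu>. object \<nu> \<and> x = Var \<nu>)"

definition formula :: "obj \<Rightarrow> bool" where
  "formula \<phi> \<longleftrightarrow> (\<exists>\<alpha> \<beta>. object \<alpha> \<and> object \<beta> \<and> \<phi> = (\<alpha> \<^bold>\<Rightarrow> \<beta>))"

definition Bot :: obj  ("\<^bold>\<bottom>") where
  "\<^bold>\<bottom> = Con Empty"

definition Neg :: "obj \<Rightarrow> obj"  ("\<^bold>\<not> _" [75] 75) where
  "\<^bold>\<not> \<alpha> = (\<alpha> \<^bold>\<Rightarrow> \<^bold>\<bottom>)"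

definition Bar :: "obj \<Rightarrow> obj" where
  "Bar \<alpha> = (Empty \<^bold>\<Rightarrow> \<alpha>)"

definition Or :: "obj \<Rightarrow> obj \<Rightarrow> obj"  (infixr "\<^bold>\<or>" 58) where
  "\<alpha> \<^bold>\<or> \<beta> = Bar (Bar \<alpha> \<^bold>\<inter> Bar \<beta>)"

definition Eq :: "obj \<Rightarrow> obj \<Rightarrow> obj"  (infix "\<^bold>=" 68) where
  "(\<alpha> \<^bold>= \<beta>) = ((\<alpha> \<^bold>\<Rightarrow> \<beta>) \<^bold>& (\<beta> \<^bold>\<Rightarrow> \<alpha>))"

definition Neq :: "obj \<Rightarrow> obj \<Rightarrow> obj"  (infix "\<^bold>\<noteq>" 68) where
  "(\<alpha> \<^bold>\<noteq> \<beta>) = \<^bold>\<not> (\<alpha> \<^bold>= \<beta>)"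

text \<open>
  The auxiliary variable \<open>b\<close> of the abbreviation for singletons remains free in it. It is made an
  explicit parameter, and is to be chosen so that it does not appear in \<open>\<alpha>\<close>.
\<close>

definition Sing :: "obj \<Rightarrow> obj \<Rightarrow> obj" where
  "Sing b \<alpha> = ((Bar \<alpha> \<^bold>\<noteq> \<alpha>) \<^bold>& ((\<alpha> \<^bold>\<Rightarrow> b) \<^bold>\<Rightarrow> (Bar b \<^bold>\<or> (\<alpha> \<^bold>= b))))"

definition Elem :: "obj \<Rightarrow> obj \<Rightarrow> obj \<Rightarrow> obj" where
  "Elem b \<alpha> \<beta> = (Sing b \<alpha> \<^bold>& (\<beta> \<^bold>\<Rightarrow> \<alpha>))"

definition Univ :: obj  ("\<^bold>V") where
  "\<^bold>V = Cls Empty"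

lemma Univ_eq_cls: "\<^bold>V = \<lbrace>x | Empty\<rbrace>"
  by (simp add: Univ_def cls_def)

definition Forall :: "obj \<Rightarrow> obj \<Rightarrow> obj"  ("(\<^bold>\<forall>_./ _)" [1000, 60] 60) where
  "(\<^bold>\<forall>x. \<phi>) = (\<^bold>V \<^bold>= \<lbrace>x | \<phi>\<rbrace>)"

text \<open>In each axiom, different letters stand for different variables.\<close>

definition distinct_variables :: "obj list \<Rightarrow> bool" where
  "distinct_variables xs \<longleftrightarrow> distinct xs \<and> (\<forall>x\<in>set xs. variable x)"

inductive derivable :: "obj \<Rightarrow> bool"  ("\<turnstile> _" [50] 50) where
  R1: "\<turnstile> \<alpha> \<Longrightarrow> \<turnstile> \<alpha> \<^bold>\<Rightarrow> \<beta> \<Longrightarrow> \<turnstile> \<beta>"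
| R2: "\<turnstile> \<alpha> \<Longrightarrow> variable x \<Longrightarrow> object \<beta> \<Longrightarrow> \<turnstile> \<alpha>\<lbrakk>x := \<beta>\<rbrakk>"
| R3: "\<turnstile> \<gamma> \<^bold>\<Rightarrow> (\<alpha> \<^bold>\<Rightarrow> \<beta>) \<Longrightarrow> variable x \<Longrightarrow> x \<notin> vars \<gamma> \<Longrightarrow>
    \<turnstile> \<gamma> \<^bold>\<Rightarrow> (\<lbrace>x | \<beta>\<rbrace> \<^bold>\<Rightarrow> \<lbrace>x | \<alpha>\<rbrace>)"
| A1: "distinct_variables [a, b, c] \<Longrightarrow>
    \<turnstile> ((c \<^bold>\<Rightarrow> a) \<^bold>& (c \<^bold>\<Rightarrow> (a \<^bold>\<Rightarrow> b))) \<^bold>\<Rightarrow> (c \<^bold>\<Rightarrow> b)"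
| A2: "distinct_variables [a, b, c, d] \<Longrightarrow>
    \<turnstile> ((d \<^bold>\<Rightarrow> (a \<^bold>\<Rightarrow> b)) \<^bold>& (d \<^bold>\<Rightarrow> (b \<^bold>\<Rightarrow> c))) \<^bold>\<Rightarrow> (d \<^bold>\<Rightarrow> (a \<^bold>\<Rightarrow> c))"
| A3: "distinct_variables [a, b, c] \<Longrightarrow>
    \<turnstile> ((c \<^bold>\<Rightarrow> a) \<^bold>& (c \<^bold>\<Rightarrow> b)) \<^bold>\<Rightarrow> (c \<^bold>\<Rightarrow> (a \<^bold>& b))"
| A4_left: "distinct_variables [a, b] \<Longrightarrow> \<turnstile> (a \<^bold>& b) \<^bold>\<Rightarrow> a"
| A4_right: "distinct_variables [a, b] \<Longrightarrow> \<turnstile> (a \<^bold>& b) \<^bold>\<Rightarrow> b"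
| A5_left: "distinct_variables [a, b] \<Longrightarrow> \<turnstile> a \<^bold>\<Rightarrow> (a \<^bold>\<inter> b)"
| A5_right: "distinct_variables [a, b] \<Longrightarrow> \<turnstile> b \<^bold>\<Rightarrow> (a \<^bold>\<inter> b)"
| A6: "distinct_variables [a, b, c] \<Longrightarrow>
    \<turnstile> ((a \<^bold>\<Rightarrow> c) \<^bold>& (b \<^bold>\<Rightarrow> c)) \<^bold>\<Rightarrow> ((a \<^bold>\<inter> b) \<^bold>\<Rightarrow> c)"
| A7: "variable a \<Longrightarrow> \<turnstile> a \<^bold>\<Rightarrow> a"
| A8: "variable a \<Longrightarrow> \<turnstile> a \<^bold>\<Rightarrow> Empty"
| A9: "variable a \<Longrightarrow> \<turnstile> \<^bold>\<bottom> \<^bold>\<Rightarrow> a"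
| A10: "distinct_variables [a, b] \<Longrightarrow>
    \<turnstile> (Empty \<^bold>\<Rightarrow> a) \<^bold>\<Rightarrow> ((Empty \<^bold>\<Rightarrow> b) \<^bold>\<Rightarrow> (a \<^bold>& b))"
| A11: "distinct_variables [a, b] \<Longrightarrow>
    \<turnstile> (a \<^bold>\<Rightarrow> b) \<^bold>\<Rightarrow> (Empty \<^bold>\<Rightarrow> (a \<^bold>\<Rightarrow> b))"
| A12: "distinct_variables [a, b] \<Longrightarrow>
    \<turnstile> (((a \<^bold>\<Rightarrow> b) \<^bold>\<Rightarrow> \<^bold>\<bottom>) \<^bold>\<Rightarrow> \<^bold>\<bottom>) \<^bold>\<Rightarrow> (a \<^bold>\<Rightarrow> b)"
| A13: "distinct_variables [a, b, x] \<Longrightarrow> object \<alpha> \<Longrightarrow>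
    \<turnstile> Elem b a \<lbrace>x | \<alpha>\<rbrace> \<^bold>= (Sing b a \<^bold>& \<alpha>\<lbrakk>x := a\<rbrakk>)"
| A14a: "distinct_variables [a, b, x] \<Longrightarrow> \<turnstile> a \<^bold>\<Rightarrow> \<lbrace>x | Elem b x a\<rbrace>"
| A14b: "distinct_variables [a, b, x] \<Longrightarrow>
    \<turnstile> (\<^bold>V \<^bold>\<Rightarrow> a) \<^bold>\<Rightarrow> (\<lbrace>x | Elem b x a\<rbrace> \<^bold>\<Rightarrow> a)"

end

theory Submission
  imports Defs
begin

text \<open>
  Every singleton \<open>a\<close> lies in \<open>V\<close> by A13, so \<open>V \<Rightarrow> a\<close>. If \<open>V\<close> equals the class of all \<open>x\<close> with \<open>\<phi>\<close>,
  then that class contains \<open>a\<close> as well, and A13 read in the other direction yields \<open>\<phi>[x := a]\<close>.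
  Since A13 requires distinct variables, the argument is carried out for a fresh variable in place of
  \<open>a\<close> and a fresh bound variable, and \<open>a\<close> is substituted at the end.
\<close>

section \<open>Variables and substitution\<close>

lemma finite_vars: "finite (vars \<alpha>)"
  by (induction \<alpha>) auto

text \<open>The names obtained by iterating \<open>Con\<close> on \<open>Empty\<close> have pairwise
  different sizes, so they give infinitely many symbols \<open>Var\<close>.\<close>

lemma infinite_variables: "infinite {x. variable x}"
proof -
  define f where "f n = Var ((Con ^^ n) Empty)" for n :: nat
  have object: "object ((Con ^^ n) Empty)" for n
    by (induction n) (auto intro: object.intros)
  have size: "size ((Con ^^ n) Empty) = n" for n
    by (induction n) auto
  have "inj f"
    unfolding f_def by (rule injI) (metis obj.inject(2) size)
  moreover have "range f \<subseteq> {x. variable x}"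
    using object by (auto simp: f_def variable_def)
  ultimately show ?thesis
    using finite_imageD infinite_super by blast
qed

lemma fresh_variable:
  assumes "finite A"
  obtains x where "variable x" and "x \<notin> A"
proof -
  have "\<not> {x. variable x} \<subseteq> A"
    using assms infinite_variables finite_subset by blast
  then show ?thesis
    using that by blast
qed

text \<open>Four letters suffice for A2, which has the most letters among the axioms instantiated
  below.\<close>

lemma fresh_variables:
  assumes "finite A"
  obtains a b c d where "distinct_variables [a, b, c, d]"
    and "a \<notin> A" and "b \<notin> A" and "c \<notin> A" and "d \<notin> A"
proof -
  obtain a where a: "variable a" "a \<notin> A"
    using assms by (rule fresh_variable)
  obtain b where b: "variable b" "b \<notin> insert a A"
    by (rule fresh_variable[of "insert a A"]) (use assms in auto)
  obtain c where c: "variable c" "c \<notin> {a, b} \<union> A"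
    by (rule fresh_variable[of "{a, b} \<union> A"]) (use assms in auto)
  obtain d where d: "variable d" "d \<notin> {a, b, c} \<union> A"
    by (rule fresh_variable[of "{a, b, c} \<union> A"]) (use assms in auto)
  show ?thesis
    by (rule that[of a b c d]) (use a b c d in \<open>auto simp: distinct_variables_def\<close>)
qed

section \<open>Substitution and renaming of variables\<close>

lemma object_variable: "variable x \<Longrightarrow> object x"
  by (auto simp: variable_def intro: object.intros)

lemma vars_variable: "variable x \<Longrightarrow> vars x = {x}"
  by (auto simp: variable_def)

lemma subst_self: "variable x \<Longrightarrow> x\<lbrakk>x := \<gamma>\<rbrakk> = \<gamma>"
  by (auto simp: variable_def)

lemma subst_fresh: "x \<notin> vars \<alpha> \<Longrightarrow> \<alpha>\<lbrakk>x := \<gamma>\<rbrakk> = \<alpha>"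
  by (induction \<alpha>) auto

lemma vars_bind: "vars (bind k x \<alpha>) \<subseteq> vars \<alpha>"
  by (induction \<alpha> arbitrary: k) auto

text \<open>All occurrences of \<open>y\<close> after the first substitution are those put in for
  \<open>x\<close>.\<close>

lemma subst_subst_fresh:
  assumes "variable y" and "y \<notin> vars \<alpha>"
  shows "\<alpha>\<lbrakk>x := y\<rbrakk>\<lbrakk>y := \<gamma>\<rbrakk> = \<alpha>\<lbrakk>x := \<gamma>\<rbrakk>"
  using assms(2) by (induction \<alpha>) (auto simp: subst_self[OF assms(1)])

lemma bind_subst_fresh:
  assumes "variable y" and "y \<notin> vars \<alpha>"
  shows "bind k y (\<alpha>\<lbrakk>x := y\<rbrakk>) = bind k x \<alpha>"
  using assms(1,2) by (induction \<alpha> arbitrary: k) (auto simp: variable_def)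

text \<open>In locally nameless form, alpha-equivalent classes are equal. This allows A13 to be
  applied with a bound variable distinct from its other letters.\<close>

lemma cls_rename:
  assumes "variable y" and "y \<notin> vars \<alpha>"
  shows "\<lbrace>y | \<alpha>\<lbrakk>x := y\<rbrakk>\<rbrace> = \<lbrace>x | \<alpha>\<rbrace>"
  by (simp add: cls_def bind_subst_fresh[OF assms])

lemma object_cls: "variable x \<Longrightarrow> object \<alpha> \<Longrightarrow> object \<lbrace>x | \<alpha>\<rbrace>"
  by (auto simp: variable_def intro: object.intros)

text \<open>
  A substitution of one variable for another may collide with a bound variable of a class, whereas
  a permutation of variables commutes with class formation; hence substitution of a fresh variable
  is treated as an instance of a swap.
\<close>

fun swap :: "obj \<Rightarrow> obj \<Rightarrow> obj \<Rightarrow> obj" where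
  "swap x y Empty = Empty"
| "swap x y (Con \<nu>) = Con \<nu>"
| "swap x y (Var \<nu>) = (if Var \<nu> = x then y else if Var \<nu> = y then x else Var \<nu>)"
| "swap x y (\<alpha> \<^bold>& \<beta>) = (swap x y \<alpha> \<^bold>& swap x y \<beta>)"
| "swap x y (\<alpha> \<^bold>\<Rightarrow> \<beta>) = (swap x y \<alpha> \<^bold>\<Rightarrow> swap x y \<beta>)"
| "swap x y (\<alpha> \<^bold>\<inter> \<beta>) = (swap x y \<alpha> \<^bold>\<inter> swap x y \<beta>)"
| "swap x y (Cls \<alpha>) = Cls (swap x y \<alpha>)"
| "swap x y (Idx i) = Idx i"

lemma swap_bind:
  assumes "variable x" and "variable y" and "variable z"
  shows "swap x y (bind k z \<alpha>) = bind k (swap x y z) (swap x y \<alpha>)"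
  using assms by (induction \<alpha> arbitrary: k) (auto simp: variable_def split: if_splits)

lemma object_swap:
  assumes "object \<alpha>" and "variable x" and "variable y"
  shows "object (swap x y \<alpha>)"
  using assms(1)
proof induction
  \<comment> \<open>A swap sends the bound variable to a variable again, so \<open>swap_bind\<close>
    exhibits the result as a class over an object.\<close>
  case (7 \<nu> \<beta>)
  have "variable (swap x y (Var \<nu>))"
    using 7 assms by (auto simp: variable_def)
  then show ?case
    using 7 object_cls swap_bind[OF assms(2,3), of "Var \<nu>" 0 \<beta>]
    by (auto simp: cls_def variable_def)
qed (use assms in \<open>auto intro: object.intros object_variable\<close>)

text \<open>As \<open>y\<close> does not occur, there is nothing for the swap to send back to
  \<open>x\<close>.\<close>

lemma subst_eq_swap: "y \<notin> vars \<alpha> \<Longrightarrow> \<alpha>\<lbrakk>x := y\<rbrakk> = swap x y \<alpha>"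
  by (induction \<alpha>) auto

lemma object_subst_fresh:
  "object \<alpha> \<Longrightarrow> variable x \<Longrightarrow> variable y \<Longrightarrow> y \<notin> vars \<alpha> \<Longrightarrow> object (\<alpha>\<lbrakk>x := y\<rbrakk>)"
  by (simp add: subst_eq_swap object_swap)

section \<open>Propositional rules\<close>

lemmas instance_simps =
  subst_self subst_fresh vars_variable distinct_variables_def

lemma imp_refl: "object \<alpha> \<Longrightarrow> \<turnstile> \<alpha> \<^bold>\<Rightarrow> \<alpha>"
proof -
  assume \<alpha>: "object \<alpha>"
  obtain a where a: "variable a" "a \<notin> {}"
    by (rule fresh_variable[of "{}"]) auto
  show ?thesis
    using R2[OF A7 a(1) \<alpha>, OF a(1)] a by (simp add: instance_simps)
qed

lemma imp_Empty: "object \<alpha> \<Longrightarrow> \<turnstile> \<alpha> \<^bold>\<Rightarrow> Empty"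
proof -
  assume \<alpha>: "object \<alpha>"
  obtain a where a: "variable a" "a \<notin> {}"
    by (rule fresh_variable[of "{}"]) auto
  show ?thesis
    using R2[OF A8 a(1) \<alpha>, OF a(1)] a by (simp add: instance_simps)
qed

lemma Empty_derivable: "\<turnstile> Empty"
proof -
  \<comment> \<open>The second formula is A8 at an object that is itself an instance of A8.\<close>
  have "\<turnstile> Empty \<^bold>\<Rightarrow> Empty" and "\<turnstile> (Empty \<^bold>\<Rightarrow> Empty) \<^bold>\<Rightarrow> Empty"
    by (rule imp_Empty; auto intro: object.intros)+
  then show ?thesis
    by (rule R1)
qed

text \<open>The axioms A4, A10 and A11 speak of variables only; R2 turns them into schemas over
  objects.\<close>

lemma
  assumes "object \<alpha>" and "object \<beta>"
  shows fed_imp_left: "\<turnstile> (\<alpha> \<^bold>& \<beta>) \<^bold>\<Rightarrow> \<alpha>"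
    and fed_imp_right: "\<turnstile> (\<alpha> \<^bold>& \<beta>) \<^bold>\<Rightarrow> \<beta>"
    and Empty_imp_fed: "\<turnstile> (Empty \<^bold>\<Rightarrow> \<alpha>) \<^bold>\<Rightarrow> ((Empty \<^bold>\<Rightarrow> \<beta>) \<^bold>\<Rightarrow> (\<alpha> \<^bold>& \<beta>))"
    and imp_Empty_imp: "\<turnstile> (\<alpha> \<^bold>\<Rightarrow> \<beta>) \<^bold>\<Rightarrow> (Empty \<^bold>\<Rightarrow> (\<alpha> \<^bold>\<Rightarrow> \<beta>))"
proof -
  obtain a b c d where fresh: "distinct_variables [a, b, c, d]"
      "a \<notin> vars \<alpha> \<union> vars \<beta>" "b \<notin> vars \<alpha> \<union> vars \<beta>"
    by (rule fresh_variables[of "vars \<alpha> \<union> vars \<beta>"]) (auto simp: finite_vars)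
  then have ab: "distinct_variables [a, b]" "variable a" "variable b"
    by (auto simp: distinct_variables_def)
  \<comment> \<open>R2 substitutes one variable at a time. Since \<open>b\<close> is fresh for
    \<alpha>, the second substitution leaves the inserted \<alpha> intact.\<close>
  have inst: "\<turnstile> \<gamma> \<Longrightarrow> \<turnstile> \<gamma>\<lbrakk>a := \<alpha>\<rbrakk>\<lbrakk>b := \<beta>\<rbrakk>" for \<gamma>
    by (intro R2 ab assms)
  show "\<turnstile> (\<alpha> \<^bold>& \<beta>) \<^bold>\<Rightarrow> \<alpha>"
    using inst[OF A4_left[OF ab(1)]] fresh by (simp add: instance_simps)
  show "\<turnstile> (\<alpha> \<^bold>& \<beta>) \<^bold>\<Rightarrow> \<beta>"
    using inst[OF A4_right[OF ab(1)]] fresh by (simp add: instance_simps)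
  show "\<turnstile> (Empty \<^bold>\<Rightarrow> \<alpha>) \<^bold>\<Rightarrow> ((Empty \<^bold>\<Rightarrow> \<beta>) \<^bold>\<Rightarrow> (\<alpha> \<^bold>& \<beta>))"
    using inst[OF A10[OF ab(1)]] fresh by (simp add: instance_simps)
  show "\<turnstile> (\<alpha> \<^bold>\<Rightarrow> \<beta>) \<^bold>\<Rightarrow> (Empty \<^bold>\<Rightarrow> (\<alpha> \<^bold>\<Rightarrow> \<beta>))"
    using inst[OF A11[OF ab(1)]] fresh by (simp add: instance_simps)
qed

lemma
  assumes "object \<alpha>" and "object \<beta>" and "object \<gamma>" and "object \<delta>"
  shows fed_imp_trans: "\<turnstile> ((\<delta> \<^bold>\<Rightarrow> (\<alpha> \<^bold>\<Rightarrow> \<beta>)) \<^bold>& (\<delta> \<^bold>\<Rightarrow> (\<beta> \<^bold>\<Rightarrow> \<gamma>))) \<^bold>\<Rightarrow> (\<delta> \<^bold>\<Rightarrow> (\<alpha> \<^bold>\<Rightarrow> \<gamma>))"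
    and fed_imp_fed: "\<turnstile> ((\<gamma> \<^bold>\<Rightarrow> \<alpha>) \<^bold>& (\<gamma> \<^bold>\<Rightarrow> \<beta>)) \<^bold>\<Rightarrow> (\<gamma> \<^bold>\<Rightarrow> (\<alpha> \<^bold>& \<beta>))"
proof -
  let ?A = "vars \<alpha> \<union> vars \<beta> \<union> vars \<gamma> \<union> vars \<delta>"
  obtain a b c d where fresh: "distinct_variables [a, b, c, d]"
      "a \<notin> ?A" "b \<notin> ?A" "c \<notin> ?A" "d \<notin> ?A"
    by (rule fresh_variables[of ?A]) (auto simp: finite_vars)
  then have abc: "distinct_variables [a, b, c]"
      and vars: "variable a" "variable b" "variable c" "variable d"
    by (auto simp: distinct_variables_def)
  have inst: "\<turnstile> \<epsilon> \<Longrightarrow> \<turnstile> \<epsilon>\<lbrakk>a := \<alpha>\<rbrakk>\<lbrakk>b := \<beta>\<rbrakk>\<lbrakk>c := \<gamma>\<rbrakk>\<lbrakk>d := \<delta>\<rbrakk>" for \<epsilon>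
    by (intro R2 vars assms)
  show "\<turnstile> ((\<delta> \<^bold>\<Rightarrow> (\<alpha> \<^bold>\<Rightarrow> \<beta>)) \<^bold>& (\<delta> \<^bold>\<Rightarrow> (\<beta> \<^bold>\<Rightarrow> \<gamma>))) \<^bold>\<Rightarrow> (\<delta> \<^bold>\<Rightarrow> (\<alpha> \<^bold>\<Rightarrow> \<gamma>))"
    using inst[OF A2[OF fresh(1)]] fresh by (simp add: instance_simps)
  show "\<turnstile> ((\<gamma> \<^bold>\<Rightarrow> \<alpha>) \<^bold>& (\<gamma> \<^bold>\<Rightarrow> \<beta>)) \<^bold>\<Rightarrow> (\<gamma> \<^bold>\<Rightarrow> (\<alpha> \<^bold>& \<beta>))"
    using inst[OF A3[OF abc]] fresh by (simp add: instance_simps)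
qed

section \<open>Derived rules for implication and federation\<close>

lemma Empty_imp_formula:
  assumes "\<turnstile> \<alpha> \<^bold>\<Rightarrow> \<beta>" and "object \<alpha>" and "object \<beta>"
  shows "\<turnstile> Empty \<^bold>\<Rightarrow> (\<alpha> \<^bold>\<Rightarrow> \<beta>)"
  using assms(1) imp_Empty_imp[OF assms(2,3)] by (rule R1)

text \<open>A10 introduces a federation only from components prefixed by \<open>Empty\<close>, and
  A11 supplies this prefix for implications; hence the restriction to formulas.\<close>

lemma fed_formulas:
  assumes "\<turnstile> \<alpha> \<^bold>\<Rightarrow> \<beta>" and "\<turnstile> \<gamma> \<^bold>\<Rightarrow> \<delta>"
    and "object \<alpha>" and "object \<beta>" and "object \<gamma>" and "object \<delta>"
  shows "\<turnstile> (\<alpha> \<^bold>\<Rightarrow> \<beta>) \<^bold>& (\<gamma> \<^bold>\<Rightarrow> \<delta>)"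
  by (rule R1[OF Empty_imp_formula[OF assms(2)] R1[OF Empty_imp_formula[OF assms(1)] Empty_imp_fed]])
    (use assms in \<open>auto intro: object.intros\<close>)

text \<open>This is A2 as a rule: \<delta> carries the hypotheses under which containments are
  chained.\<close>

lemma imp_trans_context:
  assumes "\<turnstile> \<delta> \<^bold>\<Rightarrow> (\<alpha> \<^bold>\<Rightarrow> \<beta>)" and "\<turnstile> \<delta> \<^bold>\<Rightarrow> (\<beta> \<^bold>\<Rightarrow> \<gamma>)"
    and "object \<alpha>" and "object \<beta>" and "object \<gamma>" and "object \<delta>"
  shows "\<turnstile> \<delta> \<^bold>\<Rightarrow> (\<alpha> \<^bold>\<Rightarrow> \<gamma>)"
  by (rule R1[OF fed_formulas[OF assms(1,2)] fed_imp_trans]) (use assms in \<open>auto intro: object.intros\<close>)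

lemma imp_fed:
  assumes "\<turnstile> \<gamma> \<^bold>\<Rightarrow> \<alpha>" and "\<turnstile> \<gamma> \<^bold>\<Rightarrow> \<beta>"
    and "object \<alpha>" and "object \<beta>" and "object \<gamma>"
  shows "\<turnstile> \<gamma> \<^bold>\<Rightarrow> (\<alpha> \<^bold>& \<beta>)"
  \<comment> \<open>Unification does not determine \<delta>, which comes from the hypotheses shared
    with \<open>fed_imp_trans\<close>; \<open>Empty\<close> is chosen for it.\<close>
  by (rule R1[OF fed_formulas[OF assms(1,2)] fed_imp_fed[where \<delta> = Empty]])
    (use assms in \<open>auto intro: object.intros\<close>)

lemma imp_trans:
  assumes "\<turnstile> \<alpha> \<^bold>\<Rightarrow> \<beta>" and "\<turnstile> \<beta> \<^bold>\<Rightarrow> \<gamma>"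
    and "object \<alpha>" and "object \<beta>" and "object \<gamma>"
  shows "\<turnstile> \<alpha> \<^bold>\<Rightarrow> \<gamma>"
proof -
  \<comment> \<open>Chaining takes place in the context \<open>Empty\<close>, which is derivable and
    can then be removed by R1.\<close>
  have "\<turnstile> Empty \<^bold>\<Rightarrow> (\<alpha> \<^bold>\<Rightarrow> \<gamma>)"
    by (rule imp_trans_context[where \<beta> = \<beta>])
      (use assms in \<open>auto intro: Empty_imp_formula object.intros\<close>)
  with Empty_derivable show ?thesis
    by (rule R1)
qed

section \<open>Instantiation of the universal quantifier\<close>

lemma object_Sing: "object \<alpha> \<Longrightarrow> object \<beta> \<Longrightarrow> object (Sing \<beta> \<alpha>)"
  by (auto simp: Sing_def Neq_def Neg_def Bot_def Bar_def Or_def Eq_def intro!: object.intros)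

lemma object_Univ: "object \<^bold>V"
  using object.intros(7)[of Empty Empty] by (simp add: object.intros Univ_eq_cls[of "Var Empty"])

lemma
  assumes "\<turnstile> \<alpha> \<^bold>= \<beta>" and "object \<alpha>" and "object \<beta>"
  shows Eq_imp: "\<turnstile> \<alpha> \<^bold>\<Rightarrow> \<beta>" and Eq_imp_converse: "\<turnstile> \<beta> \<^bold>\<Rightarrow> \<alpha>"
  by (rule R1[OF assms(1)[unfolded Eq_def]], intro fed_imp_left fed_imp_right object.intros assms)+

text \<open>Comprehension A13 for the class of all \<open>x\<close> with \<open>Empty\<close> makes
  every singleton a member of \<open>V\<close>; the second component of that membership is the
  containment wanted.\<close>

lemma Sing_imp_Univ_imp:
  assumes "variable a" and "variable b" and "b \<noteq> a"
  shows "\<turnstile> Sing b a \<^bold>\<Rightarrow> (\<^bold>V \<^bold>\<Rightarrow> a)"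
proof -
  obtain x where x: "variable x" "x \<notin> {a, b}"
    by (rule fresh_variable[of "{a, b}"]) auto
  note objects = object.intros(1-6) object_variable[OF assms(1)] object_variable[OF assms(2)]
    object_Sing object_Univ
  have "\<turnstile> Elem b a \<lbrace>x | Empty\<rbrace> \<^bold>= (Sing b a \<^bold>& Empty\<lbrakk>x := a\<rbrakk>)"
    by (rule A13) (use assms x in \<open>auto simp: distinct_variables_def intro: object.intros\<close>)
  then have "\<turnstile> Elem b a \<^bold>V \<^bold>= (Sing b a \<^bold>& Empty)"
    by (simp flip: Univ_eq_cls)
  then have to_Elem: "\<turnstile> (Sing b a \<^bold>& Empty) \<^bold>\<Rightarrow> (Sing b a \<^bold>& (\<^bold>V \<^bold>\<Rightarrow> a))"
    unfolding Elem_def by (rule Eq_imp_converse) (intro objects)+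
  have from_Sing: "\<turnstile> Sing b a \<^bold>\<Rightarrow> (Sing b a \<^bold>& Empty)"
    by (intro imp_fed imp_refl imp_Empty objects)
  have "\<turnstile> Sing b a \<^bold>\<Rightarrow> (Sing b a \<^bold>& (\<^bold>V \<^bold>\<Rightarrow> a))"
    by (rule imp_trans[OF from_Sing to_Elem]) (intro objects)+
  then show ?thesis
    by (rule imp_trans[OF _ fed_imp_right]) (intro objects)+
qed

lemma Sing_Forall_imp_fresh:
  assumes "object \<phi>" and "variable x" and "variable a" and "variable b" and "b \<noteq> a"
    and "a \<notin> vars \<phi>"
  shows "\<turnstile> (Sing b a \<^bold>& (\<^bold>\<forall>x. \<phi>)) \<^bold>\<Rightarrow> \<phi>\<lbrakk>x := a\<rbrakk>"
proof -
  \<comment> \<open>A13 needs a bound variable different from \<open>a\<close> and \<open>b\<close>,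
    whereas \<open>x\<close> may coincide with one of them; \<open>y\<close> replaces it.\<close>
  obtain y where y: "variable y" "y \<notin> {a, b} \<union> vars \<phi>"
    by (rule fresh_variable[of "{a, b} \<union> vars \<phi>"]) (auto simp: finite_vars)
  define C where "C = \<lbrace>x | \<phi>\<rbrace>"
  define P where "P = (Sing b a \<^bold>& (\<^bold>\<forall>x. \<phi>))"
  have P_eq: "P = (Sing b a \<^bold>& ((\<^bold>V \<^bold>\<Rightarrow> C) \<^bold>& (C \<^bold>\<Rightarrow> \<^bold>V)))"
    by (simp add: P_def C_def Forall_def Eq_def)
  have C: "object C"
    unfolding C_def by (intro object_cls assms)
  \<comment> \<open>Freshness of \<open>a\<close> for \<phi> enters here: it makes the substitution
    a swap, which preserves objects.\<close>
  have \<phi>a: "object (\<phi>\<lbrakk>x := a\<rbrakk>)"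
    by (intro object_subst_fresh assms)
  note objects = C \<phi>a object.intros(1-6) object_variable[OF assms(3)] object_variable[OF assms(4)]
    object_Sing object_Univ
  have P: "object P"
    unfolding P_eq by (intro objects)
  note objects = P objects
  have Sing: "\<turnstile> P \<^bold>\<Rightarrow> Sing b a"
    unfolding P_eq by (intro fed_imp_left objects)
  have "\<turnstile> P \<^bold>\<Rightarrow> ((\<^bold>V \<^bold>\<Rightarrow> C) \<^bold>& (C \<^bold>\<Rightarrow> \<^bold>V))"
    unfolding P_eq by (intro fed_imp_right objects)
  then have C_V: "\<turnstile> P \<^bold>\<Rightarrow> (C \<^bold>\<Rightarrow> \<^bold>V)"
    by (rule imp_trans[OF _ fed_imp_right]) (intro objects)+
  have V_a: "\<turnstile> P \<^bold>\<Rightarrow> (\<^bold>V \<^bold>\<Rightarrow> a)"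
    by (rule imp_trans[OF Sing Sing_imp_Univ_imp]) (intro objects assms)+
  \<comment> \<open>Chaining \<open>C\<close> to \<open>V\<close> to \<open>a\<close> is the passage
    from membership in \<open>V\<close> to membership in \<open>C\<close>, since \<open>a\<close>
    belongs to a class when the class implies it and \<open>a\<close> is a singleton.\<close>
  have C_a: "\<turnstile> P \<^bold>\<Rightarrow> (C \<^bold>\<Rightarrow> a)"
    by (rule imp_trans_context[OF C_V V_a]) (intro objects)+
  have Elem: "\<turnstile> P \<^bold>\<Rightarrow> (Sing b a \<^bold>& (C \<^bold>\<Rightarrow> a))"
    by (intro imp_fed Sing C_a objects)
  have "\<turnstile> Elem b a \<lbrace>y | \<phi>\<lbrakk>x := y\<rbrakk>\<rbrace> \<^bold>= (Sing b a \<^bold>& \<phi>\<lbrakk>x := y\<rbrakk>\<lbrakk>y := a\<rbrakk>)"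
    by (rule A13) (use assms y in \<open>auto simp: distinct_variables_def intro: object_subst_fresh\<close>)
  \<comment> \<open>Renaming \<open>y\<close> back to \<open>x\<close> in the class and collapsing
    the two substitutions removes \<open>y\<close> from this instance.\<close>
  then have "\<turnstile> (Sing b a \<^bold>& (C \<^bold>\<Rightarrow> a)) \<^bold>= (Sing b a \<^bold>& \<phi>\<lbrakk>x := a\<rbrakk>)"
    using y by (simp add: cls_rename subst_subst_fresh Elem_def C_def)
  then have comprehension: "\<turnstile> (Sing b a \<^bold>& (C \<^bold>\<Rightarrow> a)) \<^bold>\<Rightarrow> (Sing b a \<^bold>& \<phi>\<lbrakk>x := a\<rbrakk>)"
    by (rule Eq_imp) (intro objects)+
  have "\<turnstile> P \<^bold>\<Rightarrow> (Sing b a \<^bold>& \<phi>\<lbrakk>x := a\<rbrakk>)"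
    by (rule imp_trans[OF Elem comprehension]) (intro objects)+
  then have "\<turnstile> P \<^bold>\<Rightarrow> \<phi>\<lbrakk>x := a\<rbrakk>"
    by (rule imp_trans[OF _ fed_imp_right]) (intro objects)+
  then show ?thesis
    by (simp add: P_def)
qed

theorem theorem3p20:
  fixes \<phi> x a b :: obj
  assumes "formula \<phi>" and "variable x" and "variable a"
    and "variable b" and "b \<noteq> a"
  shows "\<turnstile> (Sing b a \<^bold>& (\<^bold>\<forall>x. \<phi>)) \<^bold>\<Rightarrow> \<phi>\<lbrakk>x := a\<rbrakk>"
proof -
  have \<phi>: "object \<phi>"
    using assms(1) by (auto simp: formula_def intro: object.intros)
  \<comment> \<open>Avoiding \<open>b\<close> keeps the auxiliary variable of \<open>Sing\<close>
    unchanged when \<open>a\<close> replaces \<open>c\<close>; avoiding \<phi> ensures that this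
    replacement affects only the places where \<open>c\<close> stands for \<open>x\<close>.\<close>
  obtain c where c: "variable c" "c \<notin> {b} \<union> vars \<phi>"
    by (rule fresh_variable[of "{b} \<union> vars \<phi>"]) (auto simp: finite_vars)
  have "\<turnstile> (Sing b c \<^bold>& (\<^bold>\<forall>x. \<phi>)) \<^bold>\<Rightarrow> \<phi>\<lbrakk>x := c\<rbrakk>"
    using \<phi> assms c by (intro Sing_Forall_imp_fresh) auto
  then have "\<turnstile> ((Sing b c \<^bold>& (\<^bold>\<forall>x. \<phi>)) \<^bold>\<Rightarrow> \<phi>\<lbrakk>x := c\<rbrakk>)\<lbrakk>c := a\<rbrakk>"
    using c(1) object_variable[OF assms(3)] by (rule R2)
  moreover have "(Sing b c)\<lbrakk>c := a\<rbrakk> = Sing b a"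
    using c assms(4)
    by (simp add: Sing_def Neq_def Neg_def Bot_def Bar_def Or_def Eq_def instance_simps)
  \<comment> \<open>Binding introduces no variables, so \<open>c\<close> is absent from the class as
    well.\<close>
  moreover have "(\<^bold>\<forall>x. \<phi>)\<lbrakk>c := a\<rbrakk> = (\<^bold>\<forall>x. \<phi>)"
    using c vars_bind[of 0 x \<phi>]
    by (intro subst_fresh) (auto simp: Forall_def Eq_def Univ_def cls_def)
  moreover have "\<phi>\<lbrakk>x := c\<rbrakk>\<lbrakk>c := a\<rbrakk> = \<phi>\<lbrakk>x := a\<rbrakk>"
    using c by (simp add: subst_subst_fresh)
  ultimately show ?thesis
    by simp
qed

end
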